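(* Let $r\geq 3$ and $n\geq r^2-3r+4$ be integers. Then in every edge coloring of $K_n^r$ with $r-2$ colors there is a monochromatic Hamiltonian Berge-cycle.
   Context: $K_n^r$ denotes the complete $r$-uniform hypergraph on $n$ vertices. A Hamiltonian Berge-cycle in an $r$-uniform hypergraph on $n$ vertices consists of an ordering $v_1,\dots,v_n$ of all vertices (the core sequence) together with distinct edges $e_1,\dots,e_n$ such that $e_j$ contains $v_j$ and $v_{j+1}$ (indices modulo $n$). It is monochromatic if all of $e_1,\dots,e_n$ have the same color. *)

theory Defs
  imports Main "HOL-Library.Ramsey" "HOL-Library.FuncSet"
begin

text \<open>A hypergraph is given by its vertex set \<open>V\<close> and its edge set \<open>E\<close>; the edge set of the
  complete \<open>r\<close>-uniform hypergraph on \<open>V\<close> is \<open>nsets V r\<close>. Indices run over \<open>0, \<dots>, card V - 1\<close>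
  instead of \<open>1, \<dots>, n\<close>.\<close>

definition hamiltonian_berge_cycle ::
    "'a set \<Rightarrow> 'a set set \<Rightarrow> (nat \<Rightarrow> 'a) \<Rightarrow> (nat \<Rightarrow> 'a set) \<Rightarrow> bool" where
  "hamiltonian_berge_cycle V E v e \<longleftrightarrow>
     bij_betw v {..<card V} V \<and>
     inj_on e {..<card V} \<and>
     (\<forall>j<card V. e j \<in> E \<and> v j \<in> e j \<and> v (Suc j mod card V) \<in> e j)"

definition monochromatic_cycle ::
    "'a set \<Rightarrow> ('a set \<Rightarrow> 'c) \<Rightarrow> (nat \<Rightarrow> 'a set) \<Rightarrow> bool" where
  "monochromatic_cycle V c e \<longleftrightarrow> (\<exists>k. \<forall>j<card V. c (e j) = k)"

end

theory Submission
  imports Defs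
begin

text \<open>Call a pair of vertices heavy in colour \<open>i\<close> if at least \<open>r - 1\<close> edges of that colour contain
  it. An edge contains at most \<open>r - 1\<close> consecutive pairs of a cyclic ordering of the vertices, so by
  Hall's theorem a Hamiltonian cycle of heavy pairs of one colour lifts to a Berge-cycle. If no colour
  has such a cycle, then Posa's theorem gives, for every colour, a nonempty set \<open>X\<close> of fewer than
  \<open>n / 2\<close> vertices each having at most \<open>card X\<close> heavy neighbours. From these one builds a set \<open>W\<close> of
  \<open>r - 1\<close> vertices that contains a light pair of each of the \<open>r - 2\<close> colours. But the
  \<open>n - r + 1 > (r - 2)\<^sup>2\<close> edges containing \<open>W\<close> include \<open>r - 1\<close> of the same colour, which makes all
  pairs in \<open>W\<close> heavy in that colour.\<close>

section \<open>Hall's theorem\<close>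

text \<open>Induction on \<open>card I\<close>. If a proper nonempty subfamily is tight, it is
  matched first and its union is removed from the other sets. If none is tight, an arbitrary choice
  for one index leaves Hall's condition intact for the rest.\<close>

theorem hall_marriage:
  assumes "finite I" and "\<And>i. i \<in> I \<Longrightarrow> finite (A i)"
    and "\<And>J. J \<subseteq> I \<Longrightarrow> card J \<le> card (\<Union>(A ` J))"
  shows "\<exists>f. inj_on f I \<and> (\<forall>i\<in>I. f i \<in> A i)"
  using assms
proof (induction "card I" arbitrary: I A rule: less_induct)
  case less
  note fin = less.prems(1) and finA = less.prems(2) and hall = less.prems(3)
  show ?case
  proof (cases "I = {}")
    case True
    then show ?thesis by auto
  next
    case False
    show ?thesis
    proof (cases "\<exists>J. J \<subseteq> I \<and> J \<noteq> {} \<and> J \<noteq> I \<and> card (\<Union>(A ` J)) \<le> card J")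
      case True
      then obtain J where J: "J \<subseteq> I" "J \<noteq> {}" "J \<noteq> I" "card (\<Union>(A ` J)) \<le> card J" by blast
      have finJ: "finite J" using J(1) fin finite_subset by blast
      have finU: "finite (\<Union>(A ` J))" using finJ finA J(1) by auto
      have "card J < card I" using J fin by (simp add: psubset_card_mono psubset_eq)
      then have "\<exists>f. inj_on f J \<and> (\<forall>i\<in>J. f i \<in> A i)"
        by (rule less.hyps) (use finJ finA hall J(1) in \<open>auto dest: subset_trans\<close>)
      then obtain f where f: "inj_on f J" "\<forall>i\<in>J. f i \<in> A i" by blast
      let ?U = "\<Union>(A ` J)"
      let ?B = "\<lambda>i. A i - ?U"
      have "card (I - J) < card I"
        using J fin by (intro psubset_card_mono) auto
      then have "\<exists>g. inj_on g (I - J) \<and> (\<forall>i\<in>I - J. g i \<in> ?B i)"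
      proof (rule less.hyps)
        fix K assume K: "K \<subseteq> I - J"
        have finK: "finite K" using K fin finite_subset by blast
        have finUK: "finite (\<Union>(?B ` K))" using finK finA K by auto
        \<comment> \<open>Hall's condition for \<open>K \<union> J\<close>, minus the tight union
          over \<open>J\<close>, yields the condition for \<open>K\<close>.\<close>
        have "card K + card J = card (K \<union> J)"
          using K finK finJ by (intro card_Un_disjoint[symmetric]) auto
        also have "\<dots> \<le> card (\<Union>(A ` (K \<union> J)))" using K J(1) by (intro hall) auto
        also have "\<Union>(A ` (K \<union> J)) = \<Union>(?B ` K) \<union> ?U" by auto
        also have "card \<dots> \<le> card (\<Union>(?B ` K)) + card ?U" by (rule card_Un_le)
        finally show "card K \<le> card (\<Union>(?B ` K))" using J(4) by linarith
      qed (use fin finA in auto)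
      then obtain g where g: "inj_on g (I - J)" "\<forall>i\<in>I - J. g i \<in> ?B i" by blast
      have "inj_on (\<lambda>i. if i \<in> J then f i else g i) I"
      proof (rule inj_onI)
        fix a b assume ab: "a \<in> I" "b \<in> I"
          and eq: "(if a \<in> J then f a else g a) = (if b \<in> J then f b else g b)"
        have sep: "f p \<noteq> g q" if "p \<in> J" "q \<in> I - J" for p q
          using that f(2) g(2) by (metis DiffD2 UN_I)
        show "a = b"
          using ab eq sep[of a b] sep[of b a] inj_onD[OF f(1)] inj_onD[OF g(1)]
          by (auto split: if_splits)
      qed
      moreover have "\<forall>i\<in>I. (if i \<in> J then f i else g i) \<in> A i" using f(2) g(2) by auto
      ultimately show ?thesis by blast
    next
      case slack: False
      obtain i where i: "i \<in> I" using False by blast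
      have "card {i} \<le> card (\<Union>(A ` {i}))" using i by (intro hall) auto
      then have "A i \<noteq> {}" by auto
      then obtain y where y: "y \<in> A i" by blast
      let ?B = "\<lambda>j. A j - {y}"
      have "card (I - {i}) < card I" using i fin by (simp add: card_gt_0_iff False)
      then have "\<exists>g. inj_on g (I - {i}) \<and> (\<forall>j\<in>I - {i}. g j \<in> ?B j)"
      proof (rule less.hyps)
        fix K assume K: "K \<subseteq> I - {i}"
        have finK: "finite K" using K fin finite_subset by blast
        show "card K \<le> card (\<Union>(?B ` K))"
        proof (cases "K = {}")
          case False
          \<comment> \<open>No proper nonempty subfamily is tight, so there is one element to spare
            and \<open>y\<close> can be given up.\<close>
          have "card K < card (\<Union>(A ` K))"
            using slack False K i by (metis DiffE le_less_linear subset_Diff_insert subset_iff)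
          moreover have "\<Union>(?B ` K) = \<Union>(A ` K) - {y}" by auto
          ultimately show ?thesis by (simp add: card_Diff_singleton_if) linarith
        qed simp
      qed (use fin finA in auto)
      then obtain g where g: "inj_on g (I - {i})" "\<forall>j\<in>I - {i}. g j \<in> ?B j" by blast
      have "inj_on (g(i := y)) I"
        using g by (auto simp: inj_on_def)
      moreover have "\<forall>j\<in>I. (g(i := y)) j \<in> A j" using g(2) y by auto
      ultimately show ?thesis by blast
    qed
  qed
qed

text \<open>Counting incidences between \<open>J\<close> and its union in two ways gives Hall's
  condition: each index has at least \<open>d\<close> of them, each element at most
  \<open>d\<close>.\<close>

lemma sdr_of_degrees:
  assumes finI: "finite I" and finA: "\<And>i. i \<in> I \<Longrightarrow> finite (A i)"
    and "d > 0"
    and left: "\<And>i. i \<in> I \<Longrightarrow> d \<le> card (A i)"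
    and right: "\<And>y. card {i \<in> I. y \<in> A i} \<le> d"
  shows "\<exists>f. inj_on f I \<and> (\<forall>i\<in>I. f i \<in> A i)"
proof (rule hall_marriage[OF finI finA])
  fix J assume J: "J \<subseteq> I"
  let ?U = "\<Union>(A ` J)"
  have finJ: "finite J" using J finI finite_subset by blast
  have finU: "finite ?U" using finJ finA J by auto
  have "card J * d = (\<Sum>i\<in>J. d)" by simp
  also have "\<dots> \<le> (\<Sum>i\<in>J. card (A i))" using left J by (intro sum_mono) auto
  also have "\<dots> = (\<Sum>i\<in>J. card {y \<in> ?U. y \<in> A i})"
    by (intro sum.cong refl arg_cong[where f = card]) auto
  also have "\<dots> = (\<Sum>y\<in>?U. card {i \<in> J. y \<in> A i})"
    by (rule sum_multicount_gen[OF finJ finU]) simp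
  also have "\<dots> \<le> (\<Sum>y\<in>?U. d)"
  proof (rule sum_mono)
    fix y
    have "card {i \<in> J. y \<in> A i} \<le> card {i \<in> I. y \<in> A i}"
      using J finI by (intro card_mono) auto
    then show "card {i \<in> J. y \<in> A i} \<le> d" using right[of y] by linarith
  qed
  finally have "card J * d \<le> card ?U * d" by simp
  then show "card J \<le> card ?U" using \<open>d > 0\<close> by simp
qed

section \<open>Hamiltonian cycles and a degree condition of Posa type\<close>

definition hamiltonian_cycle :: "'a set \<Rightarrow> ('a \<Rightarrow> 'a \<Rightarrow> bool) \<Rightarrow> 'a list \<Rightarrow> bool" where
  "hamiltonian_cycle V E xs \<longleftrightarrow> distinct xs \<and> set xs = V \<and>
     (\<forall>i<length xs. E (xs ! i) (xs ! (Suc i mod length xs)))"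

text \<open>The relation may be reflexive at some vertices, as \<open>heavy_pair\<close> can be, so
  \<open>x\<close> is excluded explicitly.\<close>

definition neighbours :: "'a set \<Rightarrow> ('a \<Rightarrow> 'a \<Rightarrow> bool) \<Rightarrow> 'a \<Rightarrow> 'a set" where
  "neighbours V E x = {y \<in> V. y \<noteq> x \<and> E x y}"

text \<open>The cycle runs along the path from \<open>p ! 0\<close> to \<open>p ! i\<close>, jumps
  to the last vertex, returns backwards to \<open>p ! Suc i\<close> and closes up at
  \<open>p ! 0\<close>.\<close>

lemma crossing_hamiltonian_cycle:
  assumes sym: "\<And>x y. E x y \<Longrightarrow> E y x"
    and p: "distinct p" "set p = V" "length p = n"
    and path: "\<And>i. Suc i < n \<Longrightarrow> E (p ! i) (p ! Suc i)"
    and i: "Suc i < n" and cross: "E (p ! 0) (p ! Suc i)" "E (p ! i) (p ! (n - 1))"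
  shows "\<exists>xs. hamiltonian_cycle V E xs"
proof -
  let ?xs = "take (Suc i) p @ rev (drop (Suc i) p)"
  have len: "length ?xs = n" using p(3) i by simp
  have low: "?xs ! j = p ! j" if "j \<le> i" for j
    using that i p(3) by (simp add: nth_append)
  have high: "?xs ! j = p ! (n + i - j)" if "i < j" "j < n" for j
  proof -
    have "?xs ! j = rev (drop (Suc i) p) ! (j - Suc i)"
      using that i p(3) by (simp add: nth_append)
    also have "\<dots> = drop (Suc i) p ! (n - Suc i - Suc (j - Suc i))"
      using that p(3) by (subst rev_nth) auto
    also have "\<dots> = p ! (n + i - j)"
      using that p(3) i by (auto intro!: arg_cong[where f = "nth p"])
    finally show ?thesis .
  qed
  have "E (?xs ! j) (?xs ! (Suc j mod n))" if j: "j < n" for j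
  proof -
    consider "j < i" | "j = i" | "i < j" "Suc j < n" | "i < j" "Suc j = n" using j by linarith
    then show ?thesis
    proof cases
      case 1
      then show ?thesis using low[of j] low[of "Suc j"] path[of j] i by simp
    next
      case 2
      then show ?thesis using low[of i] high[of "Suc i"] i cross(2) by simp
    next
      case 3
      have "Suc (n + i - Suc j) = n + i - j" using 3 by simp
      then show ?thesis
        using 3 high[of j] high[of "Suc j"] path[of "n + i - Suc j"] by (auto intro: sym)
    next
      case 4
      then have "n + i - j = Suc i" by simp
      then show ?thesis using 4 high[of j] low[of 0] cross(1) by (auto intro: sym)
    qed
  qed
  moreover have "distinct ?xs"
    using p(1) by (simp add: set_take_disj_set_drop_if_distinct)
  moreover have "set ?xs = V"
    using p(2) by (metis append_take_drop_id set_append set_rev)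
  ultimately have "hamiltonian_cycle V E ?xs"
    unfolding hamiltonian_cycle_def len by blast
  then show ?thesis by blast
qed

text \<open>Each neighbour of the first end is recorded by the index of its predecessor on the path,
  each neighbour of the last end by its own index. An index recorded twice would give crossing
  chords and hence a Hamiltonian cycle, so at most \<open>n - 1\<close> indices are shared out
  between the two ends.\<close>

lemma degree_sum_of_hamiltonian_path:
  assumes sym: "\<And>x y. E x y \<Longrightarrow> E y x"
    and p: "distinct p" "set p = V" "length p = n" and "n \<ge> 1"
    and path: "\<And>i. Suc i < n \<Longrightarrow> E (p ! i) (p ! Suc i)"
    and nonham: "\<nexists>xs. hamiltonian_cycle V E xs"
  shows "card (neighbours V E (p ! 0)) + card (neighbours V E (p ! (n - 1))) \<le> n - 1"
proof -
  let ?A = "{i. Suc i < n \<and> E (p ! 0) (p ! Suc i)}"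
  let ?B = "{i. Suc i < n \<and> E (p ! i) (p ! (n - 1))}"
  have finA: "finite ?A" and finB: "finite ?B"
    by (rule finite_subset[of _ "{..<n}"]; auto)+
  have V: "\<exists>i<n. y = p ! i" if "y \<in> V" for y
    using that p by (metis in_set_conv_nth)
  have "neighbours V E (p ! 0) \<subseteq> (\<lambda>i. p ! Suc i) ` ?A"
  proof
    fix y assume y: "y \<in> neighbours V E (p ! 0)"
    then obtain i where i: "i < n" "y = p ! i" using V by (auto simp: neighbours_def)
    with y have "i \<noteq> 0" by (metis (mono_tags) mem_Collect_eq neighbours_def)
    then obtain m where "i = Suc m" by (cases i) auto
    then show "y \<in> (\<lambda>i. p ! Suc i) ` ?A" using i y by (auto simp: neighbours_def)
  qed
  then have 1: "card (neighbours V E (p ! 0)) \<le> card ?A" using finA surj_card_le by blast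
  have "neighbours V E (p ! (n - 1)) \<subseteq> (\<lambda>i. p ! i) ` ?B"
  proof
    fix y assume y: "y \<in> neighbours V E (p ! (n - 1))"
    then obtain i where i: "i < n" "y = p ! i" using V by (auto simp: neighbours_def)
    with y have "i \<noteq> n - 1" by (auto simp: neighbours_def)
    then have "Suc i < n" using i by simp
    then show "y \<in> (\<lambda>i. p ! i) ` ?B" using i y by (auto simp: neighbours_def intro: sym)
  qed
  then have 2: "card (neighbours V E (p ! (n - 1))) \<le> card ?B" using finB surj_card_le by blast
  have "?A \<inter> ?B = {}"
    using crossing_hamiltonian_cycle[of E p V n, OF sym p path] nonham by blast
  then have "card ?A + card ?B = card (?A \<union> ?B)" using finA finB by (simp add: card_Un_disjoint)
  also have "\<dots> \<le> card {..<n - 1}" by (intro card_mono) auto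
  finally show ?thesis using 1 2 by simp
qed

lemma hamiltonian_path_of_added_edge:
  assumes cyc: "hamiltonian_cycle V (\<lambda>x y. E x y \<or> {x, y} = {u, v}) xs"
    and nonham: "\<not> hamiltonian_cycle V E xs" and n: "length xs = n" "n \<ge> 3"
  shows "\<exists>p. distinct p \<and> set p = V \<and> length p = n \<and>
    (\<forall>i. Suc i < n \<longrightarrow> E (p ! i) (p ! Suc i)) \<and> {p ! (n - 1), p ! 0} = {u, v}"
proof -
  have xs: "distinct xs" "set xs = V"
    and E': "\<And>i. i < n \<Longrightarrow> E (xs ! i) (xs ! (Suc i mod n)) \<or> {xs ! i, xs ! (Suc i mod n)} = {u, v}"
    using cyc n unfolding hamiltonian_cycle_def by auto
  obtain i where i: "i < n" "\<not> E (xs ! i) (xs ! (Suc i mod n))"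
    using nonham xs n unfolding hamiltonian_cycle_def by auto
  with E' have uv: "{xs ! i, xs ! (Suc i mod n)} = {u, v}" by blast
  \<comment> \<open>The cycle must use the added pair somewhere; the rotation makes that pair the
    closing one.\<close>
  let ?p = "rotate (Suc i) xs"
  have nth: "?p ! j = xs ! ((Suc i + j) mod n)" if "j < n" for j
    using that n nth_rotate[of j xs "Suc i"] by simp
  have last: "?p ! (n - 1) = xs ! i"
  proof -
    have "(Suc i + (n - 1)) mod n = i" using i n by simp
    then show ?thesis using nth[of "n - 1"] n by simp
  qed
  have first: "?p ! 0 = xs ! (Suc i mod n)" using nth[of 0] n by simp
  have dp: "distinct ?p" using xs by simp
  \<comment> \<open>As \<open>n \<ge> 3\<close> and the vertices are distinct, the closing pair does
    not recur as an inner step, so all inner steps lie in \<open>E\<close>.\<close>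
  have "E (?p ! j) (?p ! Suc j)" if j: "Suc j < n" for j
  proof (rule ccontr)
    assume no: "\<not> E (?p ! j) (?p ! Suc j)"
    have "Suc ((Suc i + j) mod n) mod n = (Suc i + Suc j) mod n" by (simp add: mod_Suc_eq)
    then have "?p ! Suc j = xs ! (Suc ((Suc i + j) mod n) mod n)" using nth j by simp
    moreover have "?p ! j = xs ! ((Suc i + j) mod n)" using nth j by simp
    ultimately have "{?p ! j, ?p ! Suc j} = {u, v}"
      using E'[of "(Suc i + j) mod n"] no n by auto
    then have "{?p ! j, ?p ! Suc j} = {?p ! (n - 1), ?p ! 0}" using uv first last by simp
    then have "(j = n - 1 \<and> Suc j = 0) \<or> (j = 0 \<and> Suc j = n - 1)"
      using dp j n by (auto simp: doubleton_eq_iff nth_eq_iff_index_eq simp del: rotate_Suc)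
    then show False using n by auto
  qed
  then show ?thesis using dp xs n uv first last
    by (intro exI[of _ ?p]) (auto simp del: rotate_Suc)
qed

lemma obtain_minimizer:
  fixes f :: "'b \<Rightarrow> 'd::linorder"
  assumes "finite S" "S \<noteq> {}"
  obtains x where "x \<in> S" "\<And>y. y \<in> S \<Longrightarrow> f x \<le> f y"
proof -
  obtain x where "x \<in> S" "Min (f ` S) = f x" using assms by (rule obtains_MIN)
  then show ?thesis using assms that by (metis Min_le finite_imageI imageI)
qed

lemma obtain_maximizer:
  fixes f :: "'b \<Rightarrow> 'd::linorder"
  assumes "finite S" "S \<noteq> {}"
  obtains x where "x \<in> S" "\<And>y. y \<in> S \<Longrightarrow> f y \<le> f x"
proof -
  obtain x where "x \<in> S" "Max (f ` S) = f x" using assms by (rule obtains_MAX)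
  then show ?thesis using assms that by (metis Max_ge finite_imageI imageI)
qed

text \<open>Induction on the number of missing edges. If an edge can be added without creating a
  Hamiltonian cycle, the obstruction of the larger graph serves, since degrees only drop. Otherwise
  every non-adjacent pair has degree sum below \<open>card V\<close>. For such a pair
  \<open>u\<close>, \<open>v\<close> of maximal degree sum, \<open>u\<close> having the smaller
  degree, every non-neighbour of \<open>v\<close> has degree at most that of \<open>u\<close>;
  \<open>X\<close> consists of as many of these as the degree of \<open>u\<close>.\<close>

lemma posa_obstruction:
  assumes "finite V" and "card V \<ge> 3" and "\<And>x y. E x y \<Longrightarrow> E y x"
    and "\<nexists>xs. hamiltonian_cycle V E xs"
  shows "\<exists>X\<subseteq>V. X \<noteq> {} \<and> 2 * card X < card V \<and>
    (\<forall>x\<in>X. card (neighbours V E x) \<le> card X)"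
  using assms
proof (induction "card {(a, b) \<in> V \<times> V. a \<noteq> b \<and> \<not> E a b}" arbitrary: E rule: less_induct)
  case less
  note fin = less.prems(1) and n3 = less.prems(2) and sym = less.prems(3) and nonham = less.prems(4)
  let ?d = "\<lambda>x. card (neighbours V E x)"
  let ?P = "{(a, b) \<in> V \<times> V. a \<noteq> b \<and> \<not> E a b}"
  have finP: "finite ?P" by (rule finite_subset[of _ "V \<times> V"]) (use fin in auto)
  show ?case
  proof (cases "\<exists>u v. (u, v) \<in> ?P \<and>
      (\<nexists>xs. hamiltonian_cycle V (\<lambda>x y. E x y \<or> {x, y} = {u, v}) xs)")
    case True
    then obtain u v where uv: "(u, v) \<in> ?P"
      and nh: "\<nexists>xs. hamiltonian_cycle V (\<lambda>x y. E x y \<or> {x, y} = {u, v}) xs" by blast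
    let ?E = "\<lambda>x y. E x y \<or> {x, y} = {u, v}"
    have "{(a, b) \<in> V \<times> V. a \<noteq> b \<and> \<not> ?E a b} \<subset> ?P" using uv by auto
    then have "card {(a, b) \<in> V \<times> V. a \<noteq> b \<and> \<not> ?E a b} < card ?P"
      by (rule psubset_card_mono[OF finP])
    then have "\<exists>X\<subseteq>V. X \<noteq> {} \<and> 2 * card X < card V \<and>
        (\<forall>x\<in>X. card (neighbours V ?E x) \<le> card X)"
    proof (rule less.hyps[OF _ fin n3])
      show "?E y x" if "?E x y" for x y using that sym by (metis insert_commute)
    qed (rule nh)
    then obtain X where X: "X \<subseteq> V" "X \<noteq> {}" "2 * card X < card V"
      "\<forall>x\<in>X. card (neighbours V ?E x) \<le> card X" by blast
    have "?d x \<le> card (neighbours V ?E x)" for x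
      using fin by (intro card_mono) (auto simp: neighbours_def)
    then have "\<forall>x\<in>X. ?d x \<le> card X" using X(4) le_trans by blast
    then show ?thesis using X by blast
  next
    case saturated: False
    have sum: "?d u + ?d v \<le> card V - 1" if uv: "(u, v) \<in> ?P" for u v
    proof -
      obtain xs where xs: "hamiltonian_cycle V (\<lambda>x y. E x y \<or> {x, y} = {u, v}) xs"
        using saturated uv by blast
      have len: "length xs = card V" using xs by (auto simp: hamiltonian_cycle_def distinct_card)
      obtain p where p: "distinct p" "set p = V" "length p = card V"
        and path: "\<And>i. Suc i < card V \<Longrightarrow> E (p ! i) (p ! Suc i)"
        and ends: "{p ! (card V - 1), p ! 0} = {u, v}"
        using hamiltonian_path_of_added_edge[OF xs _ len n3] nonham by blast
      have "?d (p ! 0) + ?d (p ! (card V - 1)) \<le> card V - 1"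
        using n3 by (intro degree_sum_of_hamiltonian_path[where E = E, OF sym p _ path nonham]) auto
      then show ?thesis using ends by (auto simp: doubleton_eq_iff)
    qed
    have "?P \<noteq> {}"
    proof
      assume complete: "?P = {}"
      obtain xs where xs: "set xs = V" "distinct xs" using fin finite_distinct_list by blast
      have len: "length xs = card V" using xs distinct_card by fastforce
      have "E (xs ! i) (xs ! (Suc i mod length xs))" if i: "i < length xs" for i
      proof -
        have lt: "Suc i mod length xs < length xs" using i by (intro mod_less_divisor) auto
        have "i \<noteq> Suc i mod length xs" using i len n3 by (auto simp: mod_Suc)
        then have "xs ! i \<noteq> xs ! (Suc i mod length xs)" using i lt xs(2) nth_eq_iff_index_eq by blast
        moreover have "xs ! i \<in> V" "xs ! (Suc i mod length xs) \<in> V" using i lt xs(1) by auto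
        ultimately show ?thesis using complete by blast
      qed
      then show False using nonham xs unfolding hamiltonian_cycle_def by blast
    qed
    then obtain q where q: "q \<in> ?P"
      and qmax: "\<And>q'. q' \<in> ?P \<Longrightarrow> ?d (fst q') + ?d (snd q') \<le> ?d (fst q) + ?d (snd q)"
      by (rule obtain_maximizer[OF finP, where f = "\<lambda>q. ?d (fst q) + ?d (snd q)"]) blast
    define u v where "u = (if ?d (fst q) \<le> ?d (snd q) then fst q else snd q)"
      and "v = (if ?d (fst q) \<le> ?d (snd q) then snd q else fst q)"
    have uv: "(u, v) \<in> ?P" "?d u \<le> ?d v"
      using q sym by (auto simp: u_def v_def)
    have "?d u + ?d v = ?d (fst q) + ?d (snd q)" by (simp add: u_def v_def)
    with qmax have max: "\<And>q'. q' \<in> ?P \<Longrightarrow> ?d (fst q') + ?d (snd q') \<le> ?d u + ?d v" by simp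
    have small: "2 * ?d u < card V" using sum[OF uv(1)] uv(2) n3 by linarith
    show ?thesis
    \<comment> \<open>At degree 0 the general choice of \<open>X\<close> would be empty;
      \<open>{u}\<close> replaces it.\<close>
    proof (cases "?d u = 0")
      case True
      then show ?thesis using uv n3 by (intro exI[of _ "{u}"]) auto
    next
      case False
      let ?N = "{y \<in> V. y \<noteq> v \<and> \<not> E v y}"
      have vV: "v \<in> V" using uv by auto
      \<comment> \<open>The degree sum bound leaves \<open>v\<close> with at least
        \<open>?d u\<close> non-neighbours.\<close>
      have "card V = card (insert v (neighbours V E v \<union> ?N))"
        using vV by (intro arg_cong[where f = card]) (auto simp: neighbours_def)
      also have "\<dots> = Suc (card (neighbours V E v \<union> ?N))"
        using fin by (subst card_insert_disjoint) (auto simp: neighbours_def)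
      also have "\<dots> = Suc (?d v + card ?N)"
        using fin by (subst card_Un_disjoint) (auto simp: neighbours_def)
      finally have "?d u \<le> card ?N" using sum[OF uv(1)] by linarith
      then obtain X where X: "X \<subseteq> ?N" "card X = ?d u" by (rule obtain_subset_with_card_n)
      have "?d x \<le> card X" if "x \<in> X" for x
      proof -
        have "(v, x) \<in> ?P" using that X vV by auto
        then show ?thesis using max[of "(v, x)"] X by simp
      qed
      moreover have "X \<noteq> {}" using X False by auto
      ultimately show ?thesis using X small by (intro exI[of _ X]) auto
    qed
  qed
qed

section \<open>A small set meeting every complement\<close>

definition spans_nonedge :: "('a \<Rightarrow> 'a \<Rightarrow> bool) \<Rightarrow> 'a set \<Rightarrow> bool" where
  "spans_nonedge E W \<longleftrightarrow> (\<exists>a\<in>W. \<exists>b\<in>W. a \<noteq> b \<and> \<not> E a b)"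

lemma spans_nonedgeI: "a \<in> W \<Longrightarrow> b \<in> W \<Longrightarrow> a \<noteq> b \<Longrightarrow> \<not> E a b \<Longrightarrow> spans_nonedge E W"
  unfolding spans_nonedge_def by blast

lemma spans_nonedge_mono: "spans_nonedge E W \<Longrightarrow> W \<subseteq> W' \<Longrightarrow> spans_nonedge E W'"
  unfolding spans_nonedge_def by blast

lemma obtain_nonneighbour:
  assumes "finite V" and "card A + card (neighbours V E x) < card V" and "x \<in> A" and "finite A"
  obtains y where "y \<in> V" "y \<notin> A" "y \<noteq> x" "\<not> E x y"
proof -
  have "card (A \<union> neighbours V E x) < card V" using assms card_Un_le le_less_trans by blast
  moreover have "finite (A \<union> neighbours V E x)" using assms by (auto simp: neighbours_def)
  ultimately obtain y where "y \<in> V" "y \<notin> A \<union> neighbours V E x"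
    by (meson card_mono leD subsetI)
  then show ?thesis using that assms(3) by (auto simp: neighbours_def)
qed

text \<open>For gluing two vertex sets along a common vertex, which saves the one vertex that the
  bound in \<open>nonedge_chain\<close> requires.\<close>

lemma card_Un_common:
  assumes "finite A" "finite B" "w \<in> A" "w \<in> B"
  shows "card (A \<union> B) < card A + card B"
proof -
  have "card (A \<inter> B) > 0" using assms by (auto simp: card_gt_0_iff)
  then show ?thesis using card_Un_Int[OF assms(1,2)] by linarith
qed

text \<open>The colours are processed in order of increasing \<open>card (X i)\<close>. A vertex \<open>x \<in> X i\<close> has at most
  \<open>card (X i)\<close> neighbours in \<open>E i\<close>, so in general some member of the next, larger set \<open>X j\<close> is a
  non-neighbour of \<open>x\<close>, and moving to it costs one vertex for one colour. The move is blocked only if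
  \<open>X j\<close> is exactly the neighbourhood of \<open>x\<close>; then colours \<open>i\<close> and \<open>j\<close> are served together by
  two new vertices, one of which lies in the set \<open>X m\<close> of the colour after \<open>j\<close>.\<close>

lemma nonedge_chain:
  fixes E :: "'c \<Rightarrow> 'a \<Rightarrow> 'a \<Rightarrow> bool" and X :: "'c \<Rightarrow> 'a set"
  assumes finV: "finite V" and sym: "\<And>i x y. i \<in> C \<Longrightarrow> E i x y \<Longrightarrow> E i y x"
    and XV: "\<And>i. i \<in> C \<Longrightarrow> X i \<subseteq> V" and Xne: "\<And>i. i \<in> C \<Longrightarrow> X i \<noteq> {}"
    and half: "\<And>i. i \<in> C \<Longrightarrow> 2 * card (X i) < card V"
    and deg: "\<And>i x. i \<in> C \<Longrightarrow> x \<in> X i \<Longrightarrow> card (neighbours V (E i) x) \<le> card (X i)"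
    and "finite R" "R \<subseteq> C" "i \<in> C" "x \<in> X i" "\<And>j. j \<in> R \<Longrightarrow> card (X i) \<le> card (X j)"
  shows "\<exists>W\<subseteq>V. x \<in> W \<and> card W \<le> card R + 2 \<and> (\<forall>j\<in>insert i R. spans_nonedge (E j) W)"
  using assms(7-)
proof (induction "card R" arbitrary: R i x rule: less_induct)
  case less
  note finR = less.prems(1) and RC = less.prems(2) and iC = less.prems(3)
    and xX = less.prems(4) and least = less.prems(5)
  let ?N = "neighbours V (E i) x"
  have finX: "finite (X j)" if "j \<in> C" for j using that XV finV finite_subset by blast
  have finN: "finite (neighbours V F y)" for F y using finV by (auto simp: neighbours_def)
  have xV: "x \<in> V" using xX XV iC by blast
  \<comment> \<open>The degree bound and \<open>2 * card (X j) < card V\<close> leave a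
    non-neighbour of \<open>w\<close> even outside \<open>X j\<close>.\<close>
  have away: "\<exists>y\<in>V. y \<notin> X j \<and> y \<noteq> w \<and> \<not> E j w y" if "j \<in> C" "w \<in> X j" for j w
  proof -
    have "card (X j) + card (neighbours V (E j) w) < card V"
      using that half[of j] deg[of j w] by linarith
    then show ?thesis using obtain_nonneighbour[OF finV _ that(2) finX[OF that(1)]] by blast
  qed
  \<comment> \<open>Colour \<open>i\<close> is served by at most two vertices including
    \<open>x\<close> and any prescribed \<open>y\<close> that is not a neighbour of
    \<open>x\<close>.\<close>
  have link: "\<exists>W\<subseteq>V. x \<in> W \<and> y \<in> W \<and> finite W \<and> card W \<le> 2 \<and> spans_nonedge (E i) W"
    if y: "y \<in> V" "y \<notin> ?N" for y
  proof (cases "y = x")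
    case True
    obtain z where "z \<in> V" "z \<noteq> x" "\<not> E i x z" using away[OF iC xX] by blast
    then show ?thesis using True xV
      by (intro exI[of _ "{x, z}"]) (auto intro: spans_nonedgeI[of x _ z])
  next
    case False
    then show ?thesis using y xV
      by (intro exI[of _ "{x, y}"]) (auto intro: spans_nonedgeI[of x _ y] simp: neighbours_def)
  qed
  show ?case
  proof (cases "R = {}")
    case True
    have "x \<notin> ?N" by (simp add: neighbours_def)
    from link[OF xV this] obtain W where "W \<subseteq> V" "x \<in> W" "card W \<le> 2" "spans_nonedge (E i) W"
      by blast
    then show ?thesis using True by (intro exI[of _ W]) simp
  next
    case False
    show ?thesis
    proof (cases "\<exists>j\<in>R. (\<forall>m\<in>R. card (X j) \<le> card (X m)) \<and> \<not> X j \<subseteq> ?N")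
      case True
      then obtain j z where j: "j \<in> R" "\<forall>m\<in>R. card (X j) \<le> card (X m)" and z: "z \<in> X j" "z \<notin> ?N"
        by blast
      have "card (R - {j}) < card R" using j finR by (meson card_Diff1_less)
      then have "\<exists>W\<subseteq>V. z \<in> W \<and> card W \<le> card (R - {j}) + 2 \<and>
          (\<forall>m\<in>insert j (R - {j}). spans_nonedge (E m) W)"
        by (rule less.hyps) (use finR RC j z in auto)
      then obtain W' where W': "W' \<subseteq> V" "z \<in> W'" "card W' \<le> card (R - {j}) + 2"
        "\<forall>m\<in>R. spans_nonedge (E m) W'" using j by auto
      obtain W0 where W0: "W0 \<subseteq> V" "x \<in> W0" "z \<in> W0" "finite W0" "card W0 \<le> 2"
        "spans_nonedge (E i) W0"
        using link[of z] z j RC XV by blast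
      have "finite W'" using W' finV finite_subset by blast
      \<comment> \<open>The sets share \<open>z\<close>, so their union has at most
        \<open>2 + (card R + 1) - 1\<close> elements.\<close>
      then have "card (W0 \<union> W') < card W0 + card W'" using W0 W' by (intro card_Un_common) auto
      moreover have "card (R - {j}) = card R - 1" "card R > 0"
        using j finR by (auto simp: card_gt_0_iff)
      ultimately have "card (W0 \<union> W') \<le> card R + 2" using W0 W' by linarith
      moreover have "\<forall>m\<in>insert i R. spans_nonedge (E m) (W0 \<union> W')"
        using W0(6) W'(4) by (auto intro: spans_nonedge_mono)
      ultimately show ?thesis using W0 W' by (intro exI[of _ "W0 \<union> W'"]) auto
    next
      case blocked: False
      obtain j where j: "j \<in> R" "\<And>m. m \<in> R \<Longrightarrow> card (X j) \<le> card (X m)"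
        by (rule obtain_minimizer[OF finR False, where f = "\<lambda>m. card (X m)"]) blast
      have jC: "j \<in> C" using j RC by blast
      have sub: "X j \<subseteq> ?N" using blocked j by blast
      \<comment> \<open>Equality is forced by
        \<open>card ?N \<le> card (X i) \<le> card (X j)\<close>.\<close>
      have XN: "X j = ?N"
        using sub finN deg[OF iC xX] least[OF j(1)] by (intro card_seteq) auto
      \<comment> \<open>Some light pair of colour \<open>j\<close> contains \<open>w\<close> and has
        an end \<open>a\<close> outside \<open>X j = ?N\<close>: either \<open>w\<close> itself or,
        if \<open>w \<in> X j\<close>, a partner supplied by \<open>away\<close>. Linking
        \<open>x\<close> to \<open>a\<close> serves colour \<open>i\<close>, and the other end is
        the third vertex.\<close>
      have step: "\<exists>W\<subseteq>V. x \<in> W \<and> w \<in> W \<and> finite W \<and> card W \<le> 3 \<and>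
          spans_nonedge (E i) W \<and> spans_nonedge (E j) W"
        if w: "w \<in> V" "w' \<in> V" "w' \<noteq> w" "\<not> E j w w'" for w w'
      proof -
        have "\<exists>a\<in>V. \<exists>b\<in>V. a \<notin> X j \<and> a \<noteq> b \<and> spans_nonedge (E j) {a, b} \<and> w \<in> {a, b}"
        proof (cases "w \<in> X j")
          case True
          then obtain y where "y \<in> V" "y \<notin> X j" "y \<noteq> w" "\<not> E j w y" using away[OF jC] by blast
          then show ?thesis using w
            by - (rule bexI[of _ y], rule bexI[of _ w], auto intro: spans_nonedgeI[of w _ y])
        next
          case False
          then show ?thesis using w
            by - (rule bexI[of _ w], rule bexI[of _ w'], auto intro: spans_nonedgeI[of w _ w'])
        qed
        then obtain a b where ab: "a \<in> V" "b \<in> V" "a \<notin> X j" "a \<noteq> b"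
          "spans_nonedge (E j) {a, b}" "w \<in> {a, b}" by blast
        obtain W0 where W0: "W0 \<subseteq> V" "x \<in> W0" "a \<in> W0" "finite W0" "card W0 \<le> 2"
          "spans_nonedge (E i) W0"
          using link[of a] ab XN by blast
        have "spans_nonedge (E i) (insert b W0)" "spans_nonedge (E j) (insert b W0)"
          using W0(3,6) ab(5) by (auto intro: spans_nonedge_mono)
        moreover have "card (insert b W0) \<le> 3" using W0(4,5) by (simp add: card_insert_if)
        ultimately show ?thesis using W0 ab by (intro exI[of _ "insert b W0"]) auto
      qed
      show ?thesis
      proof (cases "R = {j}")
        case True
        obtain w where w: "w \<in> X j" using Xne jC by blast
        obtain y where y: "y \<in> V" "y \<noteq> w" "\<not> E j w y" using away[OF jC w] by blast
        have "w \<in> V" using w XV jC by blast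
        from step[OF this y] obtain W where "W \<subseteq> V" "x \<in> W" "card W \<le> 3"
          "spans_nonedge (E i) W" "spans_nonedge (E j) W" by blast
        then show ?thesis using True by (intro exI[of _ W]) auto
      next
        case False
        then have "R - {j} \<noteq> {}" using j by blast
        then obtain m where m: "m \<in> R - {j}" "\<And>l. l \<in> R - {j} \<Longrightarrow> card (X m) \<le> card (X l)"
          by (rule obtain_minimizer[OF finite_Diff[OF finR], where f = "\<lambda>m. card (X m)"]) blast
        have mC: "m \<in> C" using m RC by blast
        \<comment> \<open>The next start \<open>w\<close> must miss some vertex in colour
          \<open>j\<close>. If \<open>X m\<close> is no larger than \<open>X j\<close>, it is
          blocked too and lies in \<open>X j\<close>. If it is larger and all its vertices were
          joined to everything, a vertex of \<open>X j\<close> would have too many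
          neighbours.\<close>
        have "\<exists>w\<in>X m. \<exists>w'\<in>V. w' \<noteq> w \<and> \<not> E j w w'"
        proof (cases "card (X m) \<le> card (X j)")
          case True
          then have "X m \<subseteq> ?N" using blocked m j by (meson DiffD1 le_trans)
          then show ?thesis using XN away[OF jC] Xne[OF mC] by blast
        next
          case big: False
          show ?thesis
          proof (rule ccontr)
            assume "\<not> ?thesis"
            then have univ: "\<And>a b. a \<in> X m \<Longrightarrow> b \<in> V \<Longrightarrow> b \<noteq> a \<Longrightarrow> E j a b" by auto
            obtain u where u: "u \<in> X j" using Xne[OF jC] by blast
            obtain y where y: "y \<in> V" "y \<noteq> u" "\<not> E j u y" using away[OF jC u] by blast
            have uV: "u \<in> V" using u XV jC by blast
            have "X m \<subseteq> neighbours V (E j) u"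
            proof
              fix t assume t: "t \<in> X m"
              have "t \<noteq> u" using univ[of t y] t y by auto
              then have "E j t u" using univ[of t u] t uV by simp
              with t \<open>t \<noteq> u\<close> show "t \<in> neighbours V (E j) u"
                using XV[OF mC] sym[OF jC] by (auto simp: neighbours_def)
            qed
            then have "card (X m) \<le> card (X j)"
              by (rule le_trans[OF card_mono[OF finN] deg[OF jC u]])
            then show False using big by simp
          qed
        qed
        then obtain w w' where w: "w \<in> X m" "w' \<in> V" "w' \<noteq> w" "\<not> E j w w'" by blast
        have "w \<in> V" using w XV mC by blast
        from step[OF this w(2-4)] obtain W0 where W0: "W0 \<subseteq> V" "x \<in> W0" "w \<in> W0" "finite W0"
          "card W0 \<le> 3" "spans_nonedge (E i) W0" "spans_nonedge (E j) W0" by blast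
        have cR: "card (R - {j} - {m}) + 2 = card R"
          using m j finR by (metis add_2_eq_Suc' card_Suc_Diff1 finite_Diff)
        then have "card (R - {j} - {m}) < card R" by simp
        then have "\<exists>W\<subseteq>V. w \<in> W \<and> card W \<le> card (R - {j} - {m}) + 2 \<and>
            (\<forall>l\<in>insert m (R - {j} - {m}). spans_nonedge (E l) W)"
          by (rule less.hyps) (use finR RC m w in auto)
        then obtain W' where W': "W' \<subseteq> V" "w \<in> W'" "card W' \<le> card R"
          "\<forall>l\<in>R - {j}. spans_nonedge (E l) W'" using cR m(1) by auto
        have "finite W'" using W' finV finite_subset by blast
        \<comment> \<open>Here the sizes are at most 3 and \<open>card R\<close>, with
          \<open>w\<close> in common.\<close>
        then have "card (W0 \<union> W') < card W0 + card W'" using W0 W' by (intro card_Un_common) auto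
        then have "card (W0 \<union> W') \<le> card R + 2" using W0 W' by linarith
        moreover have "\<forall>l\<in>insert i R. spans_nonedge (E l) (W0 \<union> W')"
          using W0(6,7) W'(4) by (metis DiffI empty_iff insert_iff spans_nonedge_mono sup_ge1 sup_ge2)
        ultimately show ?thesis using W0 W' by (intro exI[of _ "W0 \<union> W'"]) auto
      qed
    qed
  qed
qed

text \<open>The obstructions from \<open>posa_obstruction\<close> are fed to
  \<open>nonedge_chain\<close>, starting at a colour whose set is smallest;
  \<open>card C - 1\<close> colours remain for the chain.\<close>

lemma spanning_set_of_nonhamiltonian_graphs:
  fixes E :: "'c \<Rightarrow> 'a \<Rightarrow> 'a \<Rightarrow> bool"
  assumes finV: "finite V" and "card V \<ge> 3" and "finite C" and "C \<noteq> {}"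
    and sym: "\<And>i x y. i \<in> C \<Longrightarrow> E i x y \<Longrightarrow> E i y x"
    and nonham: "\<And>i. i \<in> C \<Longrightarrow> \<nexists>xs. hamiltonian_cycle V (E i) xs"
  shows "\<exists>W\<subseteq>V. card W \<le> card C + 1 \<and> (\<forall>i\<in>C. spans_nonedge (E i) W)"
proof -
  have "\<forall>i\<in>C. \<exists>X\<subseteq>V. X \<noteq> {} \<and> 2 * card X < card V \<and>
      (\<forall>x\<in>X. card (neighbours V (E i) x) \<le> card X)"
    by (intro ballI posa_obstruction[OF finV \<open>card V \<ge> 3\<close>]) (use sym nonham in auto)
  then obtain X where X: "\<And>i. i \<in> C \<Longrightarrow> X i \<subseteq> V" "\<And>i. i \<in> C \<Longrightarrow> X i \<noteq> {}"
    "\<And>i. i \<in> C \<Longrightarrow> 2 * card (X i) < card V"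
    "\<And>i x. i \<in> C \<Longrightarrow> x \<in> X i \<Longrightarrow> card (neighbours V (E i) x) \<le> card (X i)"
    by metis
  obtain i where i: "i \<in> C" "\<And>j. j \<in> C \<Longrightarrow> card (X i) \<le> card (X j)"
    by (rule obtain_minimizer[OF \<open>finite C\<close> \<open>C \<noteq> {}\<close>, where f = "\<lambda>m. card (X m)"]) blast
  obtain x where x: "x \<in> X i" using X(2) i by blast
  have "\<exists>W\<subseteq>V. x \<in> W \<and> card W \<le> card (C - {i}) + 2 \<and>
      (\<forall>j\<in>insert i (C - {i}). spans_nonedge (E j) W)"
    by (rule nonedge_chain[OF finV sym X]) (use i x \<open>finite C\<close> in auto)
  moreover have "card (C - {i}) + 2 = card C + 1"
    using i \<open>finite C\<close> by (metis add_2_eq_Suc' card_Suc_Diff1 Suc_eq_plus1)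
  ultimately show ?thesis using i by (metis insert_Diff)
qed

section \<open>Monochromatic Berge-cycles\<close>

text \<open>Of the \<open>r\<close> positions occupied by \<open>e\<close>, one has its successor
  outside \<open>e\<close>. Otherwise these positions would be closed under cyclic successor and
  fill the whole cycle, against \<open>r < n\<close>.\<close>

lemma card_consecutive_pairs_le:
  assumes xs: "distinct xs" "set xs = V" and n: "length xs = n"
    and e: "e \<subseteq> V" "card e = r" and r: "0 < r" "r < n"
  shows "card {j. j < n \<and> xs ! j \<in> e \<and> xs ! (Suc j mod n) \<in> e} \<le> r - 1"
proof -
  let ?J = "{j. j < n \<and> xs ! j \<in> e}"
  let ?K = "{j. j < n \<and> xs ! j \<in> e \<and> xs ! (Suc j mod n) \<in> e}"
  have "bij_betw ((!) xs) ?J e"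
  proof -
    have "inj_on ((!) xs) ?J" using xs n by (auto simp: inj_on_def nth_eq_iff_index_eq)
    moreover have "(!) xs ` ?J = e"
    proof
      show "e \<subseteq> (!) xs ` ?J" using e xs n by (auto simp: image_iff) (metis in_set_conv_nth subsetD)
    qed auto
    ultimately show ?thesis by (simp add: bij_betw_def)
  qed
  then have J: "card ?J = r" using e bij_betw_same_card by blast
  have "?K \<noteq> ?J"
  proof
    assume eq: "?K = ?J"
    have closed: "Suc j mod n \<in> ?J" if "j \<in> ?J" for j
    proof -
      have "j \<in> ?K" using that eq by blast
      then show ?thesis using r by simp
    qed
    obtain j where j: "j \<in> ?J" using J r by (metis (no_types, lifting) card.empty equals0I less_irrefl)
    have all: "(j + m) mod n \<in> ?J" for m
    proof (induction m)
      case (Suc m)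
      have "Suc ((j + m) mod n) mod n = (j + Suc m) mod n" by (simp add: mod_Suc_eq)
      then show ?case using closed[OF Suc] by simp
    qed (use j in simp)
    have "l \<in> ?J" if "l < n" for l
    proof -
      have "(j + (n - j + l)) mod n = l" using that j by simp
      then show ?thesis using all[of "n - j + l"] by simp
    qed
    then have "{..<n} \<subseteq> ?J" by blast
    then have "n \<le> card ?J" using card_mono[of ?J "{..<n}"] by simp
    then show False using J r by simp
  qed
  then have "?K \<subset> ?J" by blast
  then have "card ?K < card ?J" by (intro psubset_card_mono) auto
  then show ?thesis using J by simp
qed

definition heavy_pair :: "'a set \<Rightarrow> nat \<Rightarrow> ('a set \<Rightarrow> 'c) \<Rightarrow> 'c \<Rightarrow> 'a \<Rightarrow> 'a \<Rightarrow> bool" where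
  "heavy_pair V r c k x y \<longleftrightarrow> r - 1 \<le> card {e \<in> nsets V r. c e = k \<and> x \<in> e \<and> y \<in> e}"

lemma berge_cycle_of_heavy_cycle:
  assumes finV: "finite V" and r: "2 \<le> r" "r < card V"
    and cyc: "hamiltonian_cycle V (heavy_pair V r c k) xs"
  shows "\<exists>v e. hamiltonian_berge_cycle V (nsets V r) v e \<and> monochromatic_cycle V c e"
proof -
  define n where "n = card V"
  have xs: "distinct xs" "set xs = V" and len: "length xs = n"
    using cyc by (auto simp: hamiltonian_cycle_def n_def distinct_card)
  define A where "A j = {e \<in> nsets V r. c e = k \<and> xs ! j \<in> e \<and> xs ! (Suc j mod n) \<in> e}" for j
  have fin: "finite (A j)" for j
    unfolding A_def using finite_imp_finite_nsets[OF finV] by simp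
  \<comment> \<open>Here \<open>d = r - 1\<close>: heaviness is the lower bound,
    \<open>card_consecutive_pairs_le\<close> the upper one.\<close>
  have "\<exists>f. inj_on f {..<n} \<and> (\<forall>j\<in>{..<n}. f j \<in> A j)"
  proof (rule sdr_of_degrees)
    show "r - 1 \<le> card (A j)" if "j \<in> {..<n}" for j
      using that cyc len unfolding hamiltonian_cycle_def heavy_pair_def A_def by auto
    show "card {j \<in> {..<n}. e \<in> A j} \<le> r - 1" for e
    proof (cases "e \<in> nsets V r")
      case True
      then have "card {j. j < n \<and> xs ! j \<in> e \<and> xs ! (Suc j mod n) \<in> e} \<le> r - 1"
        using r by (intro card_consecutive_pairs_le[OF xs len]) (auto simp: nsets_def n_def)
      moreover have "card {j \<in> {..<n}. e \<in> A j} \<le>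
          card {j. j < n \<and> xs ! j \<in> e \<and> xs ! (Suc j mod n) \<in> e}"
        by (intro card_mono) (auto simp: A_def)
      ultimately show ?thesis by linarith
    qed (simp add: A_def)
  qed (use r fin in auto)
  then obtain f where f: "inj_on f {..<n}" "\<And>j. j < n \<Longrightarrow> f j \<in> A j" by auto
  have "bij_betw ((!) xs) {..<n} V"
    using xs len bij_betw_nth by blast
  then have "hamiltonian_berge_cycle V (nsets V r) ((!) xs) f"
    using f unfolding hamiltonian_berge_cycle_def n_def[symmetric] by (auto simp: A_def)
  moreover have "monochromatic_cycle V c f"
    using f(2) unfolding monochromatic_cycle_def n_def[symmetric] by (auto simp: A_def)
  ultimately show ?thesis by blast
qed

theorem theorem2p3:
  fixes r n :: nat and V :: "'a set" and C :: "'c set" and c :: "'a set \<Rightarrow> 'c"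
  assumes "r \<ge> 3"
    and "int n \<ge> (int r)^2 - 3 * int r + 4"
    and "finite V" and "card V = n"
    and "finite C" and "card C = r - 2"
    and "c \<in> nsets V r \<rightarrow> C"
  shows "\<exists>v e. hamiltonian_berge_cycle V (nsets V r) v e \<and> monochromatic_cycle V c e"
proof (rule ccontr)
  assume contra: "\<not> ?thesis"
  \<comment> \<open>With \<open>k\<close> the number of colours, the bound on \<open>n\<close>
    becomes \<open>k * k + k + 2\<close>.\<close>
  obtain k where k: "r = k + 2" "k \<ge> 1" using \<open>r \<ge> 3\<close> by (intro that[of "r - 2"]) auto
  have "int (k * k + k + 2) \<le> int n"
    using assms(2) k by (simp add: power2_eq_square algebra_simps)
  then have n: "k * k + k + 2 \<le> n" by linarith
  have rn: "r < n"
  proof -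
    have "1 \<le> k * k" using k by simp
    then show ?thesis using n k by linarith
  qed
  have "\<exists>W\<subseteq>V. card W \<le> card C + 1 \<and> (\<forall>i\<in>C. spans_nonedge (heavy_pair V r c i) W)"
  proof (rule spanning_set_of_nonhamiltonian_graphs)
    show "heavy_pair V r c i y x" if "heavy_pair V r c i x y" for i x y
      using that by (simp add: heavy_pair_def conj_commute)
    show "\<nexists>xs. hamiltonian_cycle V (heavy_pair V r c i) xs" for i
    proof
      assume "\<exists>xs. hamiltonian_cycle V (heavy_pair V r c i) xs"
      then obtain xs where xs: "hamiltonian_cycle V (heavy_pair V r c i) xs" ..
      have "2 \<le> r" "r < card V" using assms(1,4) rn by auto
      from berge_cycle_of_heavy_cycle[OF \<open>finite V\<close> this xs] contra show False by contradiction
    qed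
    show "C \<noteq> {}" using assms k by auto
  qed (use assms rn in auto)
  then obtain W0 where W0: "W0 \<subseteq> V" "card W0 \<le> k + 1"
    "\<forall>i\<in>C. spans_nonedge (heavy_pair V r c i) W0"
    using assms k by auto
  \<comment> \<open>Padding to exactly \<open>r - 1\<close> vertices makes \<open>insert z W\<close>
    an edge for every further vertex \<open>z\<close>; the light pairs of \<open>W0\<close> remain
    inside.\<close>
  obtain W where W: "W0 \<subseteq> W" "W \<subseteq> V" "card W = k + 1"
    using exists_subset_between[of W0 "k + 1" V] W0 assms rn k by auto
  have finW: "finite W" using W assms finite_subset by blast
  have edge: "insert z W \<in> nsets V r" if "z \<in> V - W" for z
    using that W finW k by (auto simp: nsets_def)
  have "\<exists>i\<in>C. k + 1 \<le> card {z \<in> V - W. c (insert z W) = i}"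
  proof (rule ccontr)
    assume no: "\<not> ?thesis"
    have "card (V - W) = card (\<Union>i\<in>C. {z \<in> V - W. c (insert z W) = i})"
      using edge assms(7) by (intro arg_cong[where f = card]) auto
    also have "\<dots> \<le> (\<Sum>i\<in>C. card {z \<in> V - W. c (insert z W) = i})"
      using assms(5) by (rule card_UN_le)
    also have "\<dots> \<le> (\<Sum>i\<in>C. k)" using no by (intro sum_mono) (simp add: not_less_eq_eq)
    also have "\<dots> = k * k" using assms k by simp
    finally have "card (V - W) \<le> k * k" .
    moreover have "card (V - W) = n - (k + 1)" using W finW assms by (simp add: card_Diff_subset)
    ultimately show False using n by linarith
  qed
  then obtain i where i: "i \<in> C" "k + 1 \<le> card {z \<in> V - W. c (insert z W) = i}" by blast
  obtain a b where ab: "a \<in> W" "b \<in> W" "\<not> heavy_pair V r c i a b"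
    using W0(3) W(1) i(1) unfolding spans_nonedge_def by blast
  let ?Z = "{z \<in> V - W. c (insert z W) = i}"
  \<comment> \<open>Different \<open>z\<close> give different edges, all containing \<open>a\<close>
    and \<open>b\<close>, so the light pair has at least \<open>k + 1 = r - 1\<close> edges of
    colour \<open>i\<close>.\<close>
  have "card ?Z = card ((\<lambda>z. insert z W) ` ?Z)"
    by (intro card_image[symmetric]) (auto simp: inj_on_def)
  also have "\<dots> \<le> card {e \<in> nsets V r. c e = i \<and> a \<in> e \<and> b \<in> e}"
    using edge ab finite_imp_finite_nsets[OF assms(3)] by (intro card_mono) auto
  finally show False using i(2) ab(3) k by (simp add: heavy_pair_def)
qed

end
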